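(* Let $X, Y, W$ be Banach spaces and let $L$ be a nonempty symmetric and closed subset of $S_X\times S_{Y^*}$ having property $(P)$. Let $(\mathcal{Z}, \|\cdot\|_{\mathcal{Z}})$ be a Banach space included in $(C_{b,e}(L, W), \|\cdot\|_{\infty})$ such that: (i) $\|\cdot\|_{\mathcal{Z}}\geq \|\cdot\|_{\infty}$ on $\mathcal{Z}$; (ii) $\mathcal{Z}$ contains $[\mathcal{F}(X,Y)]\oplus W$, and $\|[T]\oplus w\|_{\mathcal{Z}}\leq \|T\|\,\|w\|$ for all $(T,w)\in \mathcal{F}(X,Y)\times W$. Then, for every $\Theta \in C_{b,e}(L, W)$, the set $$\mathcal{G}(\Theta):=\{ \Phi \in \mathcal{Z}: \Theta+\Phi \text{ attains } d_H\text{-strongly its maximum on } L\}$$ is the complement of a $\sigma$-porous subset of $(\mathcal{Z}, \|\cdot\|_{\mathcal{Z}})$. Moreover, for every $\varepsilon >0$ there exists $\eta(\varepsilon)>0$ such that whenever $\Phi\in \mathcal{Z}$ with $\|\Phi\|_{\infty}=1$ and $(x,y^* )\in L$ satisfy $\|\Phi(x,y^* )\|>1-\eta(\varepsilon)$, there are $\Psi \in \mathcal{Z}$ with $\|\Psi\|_{\infty}=1$ and $(z,t^* )\in L$ such that $$\|\Psi(z,t^* )\|=1, \quad \|x-z\|+\|y^*-t^*\| < \varepsilon \quad\text{and}\quad \|\Psi-\Phi\|_{\infty}<\varepsilon.$$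
   Context: All Banach spaces are real and nonzero. $S_X$, $B_X$ are the unit sphere and closed unit ball of $X$, and $X^*$ its topological dual. $X\times Y^*$ carries the norm $\|(x,y^* )\|=\|x\|+\|y^*\|$. A set $L$ is symmetric if $L=-L$. For $(x,y^* )\in X\times Y^*$ put $\Gamma(x,y^* )=\{(x,y^* ),(-x,-y^* )\}$, and let $d_H$ be the Hausdorff distance, so that $$d_H(\Gamma(x,y^* ),\Gamma(z,t^* ))=\min(\|x-z\|+\|y^*-t^*\|,\ \|x+z\|+\|y^*+t^*\|).$$ Property $(P)$: a nonempty symmetric closed subset $L$ of $S_X\times S_{Y^*}$ has property $(P)$ (in $X\times Y^*$) if for every $\varepsilon>0$ small enough (i.e. for all $\varepsilon\in(0,\varepsilon_0)$ for some $\varepsilon_0>0$) there is $\varpi(\varepsilon)>0$ such that for every $(x,y^* )\in L$ there exists $(x^*_\varepsilon,y_\varepsilon)\in B_{X^*}\times B_Y$ satisfying, for all $(z,t^* )\in L$, $$d_H(\Gamma(x,y^* ), \Gamma(z,t^* )) \geq \varepsilon \Longrightarrow x^*_{\varepsilon}(x) +y^*(y_\varepsilon)- \varpi (\varepsilon) \geq |x^*_{\varepsilon} (z)|+|t^*(y_\varepsilon)|.$$ $C_{b,e}(L,W)$ is the space of bounded norm-continuous functions $\Phi:L\to W$ that are even ($\Phi(-u)=\Phi(u)$ for $u\in L$), with the sup-norm $\|\cdot\|_\infty$. "A Banach space included in" it means a linear subspace $\mathcal{Z}$ with its own complete norm $\|\cdot\|_{\mathcal{Z}}$. $\Phi\in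 C_{b,e}(L,W)$ attains $d_H$-strongly its maximum on $L$ if there is $u_0\in L$ with $\|\Phi(u_0)\|=\sup_{u\in L}\|\Phi(u)\|$ and $d_H(\Gamma(u_n),\Gamma(u_0))\to 0$ whenever $(u_n)\subseteq L$ and $\|\Phi(u_n)\|\to\sup_{u\in L}\|\Phi(u)\|$. $\mathcal{F}(X,Y)$ is the space of finite rank bounded linear operators from $X$ into $Y$, and $[\mathcal{F}(X,Y)]\oplus W:=\{ [T]\oplus w: T\in \mathcal{F}(X,Y), w\in W\}$, where $[T]\oplus w$ is the map $(x,y^* )\mapsto y^*(T(x))\,w$ from $X\times Y^*$ to $W$, regarded by restriction as a function on $L$. A subset $A$ of a metric space $(M,d)$ is porous if there exist $\lambda_0\in(0,1]$ and $r_0>0$ such that for any $x\in M$ and $r\in(0,r_0]$ there is $y\in M$ with $\mathring{B}(y;\lambda_0 r)\subseteq \mathring{B}(x;r)\cap (M\setminus A)$, where $\mathring{B}(x;r)$ is the open ball of centre $x$ and radius $r$. $A$ is $\sigma$-porous if it is a countable union of porous sets. *)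

theory Defs
  imports "HOL-Analysis.Analysis"
begin

text \<open>
  The library norm on a product is the Euclidean combination, so the sum metric of
  \<open>X \<times> Y\<^sup>*\<close> is introduced separately. Both norms are equivalent, so the library's \<open>closed\<close> and
  \<open>continuous_on\<close> on the product are the right notions.
\<close>

definition sum_dist ::
  "'a::real_normed_vector \<times> 'b::real_normed_vector \<Rightarrow> 'a \<times> 'b \<Rightarrow> real" where
  "sum_dist u v = norm (fst u - fst v) + norm (snd u - snd v)"

text \<open>Meaningful for nonempty bounded sets, where all suprema and infima are genuine.\<close>

definition hausdorff_dist :: "('a \<Rightarrow> 'a \<Rightarrow> real) \<Rightarrow> 'a set \<Rightarrow> 'a set \<Rightarrow> real" where
  "hausdorff_dist d A B = max (SUP a\<in>A. INF b\<in>B. d a b) (SUP b\<in>B. INF a\<in>A. d a b)"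

definition Gam :: "'a::real_normed_vector \<times> 'b::real_normed_vector \<Rightarrow> ('a \<times> 'b) set" where
  "Gam u = {u, - u}"

abbreviation d_H ::
  "('a::real_normed_vector \<times> 'b::real_normed_vector) set \<Rightarrow> ('a \<times> 'b) set \<Rightarrow> real" where
  "d_H \<equiv> hausdorff_dist sum_dist"

lemma d_H_Gam:
  "d_H (Gam (x, y)) (Gam (z, t)) =
     min (norm (x - z) + norm (y - t)) (norm (x + z) + norm (y + t))"
proof -
  have minus: "norm (- a - b) = norm (a + b)" for a b :: "'c::real_normed_vector"
    by (metis minus_add_distrib norm_minus_cancel uminus_add_conv_diff add.commute)
  have dists:
    "sum_dist (x, y) (z, t) = norm (x - z) + norm (y - t)"
    "sum_dist (- x, - y) (- z, - t) = norm (x - z) + norm (y - t)"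
    "sum_dist (x, y) (- z, - t) = norm (x + z) + norm (y + t)"
    "sum_dist (- x, - y) (z, t) = norm (x + z) + norm (y + t)"
    by (simp_all add: sum_dist_def minus norm_minus_commute add.commute)
  show ?thesis
    unfolding hausdorff_dist_def Gam_def
    by (simp add: cInf_eq_Min cSup_eq_Max dists min.commute)
qed

definition property_P ::
  "('x::real_normed_vector \<times> ('y::real_normed_vector \<Rightarrow>\<^sub>L real)) set \<Rightarrow> bool" where
  "property_P L \<longleftrightarrow>
     (\<exists>\<epsilon>\<^sub>0>0. \<forall>\<epsilon>. 0 < \<epsilon> \<and> \<epsilon> < \<epsilon>\<^sub>0 \<longrightarrow>
       (\<exists>\<omega>>0. \<forall>(x, ys) \<in> L.
         \<exists>(xs :: 'x \<Rightarrow>\<^sub>L real) \<in> cball 0 1. \<exists>y \<in> cball 0 1.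
           \<forall>(z, ts) \<in> L. d_H (Gam (x, ys)) (Gam (z, ts)) \<ge> \<epsilon> \<longrightarrow>
             blinfun_apply xs x + blinfun_apply ys y - \<omega>
               \<ge> \<bar>blinfun_apply xs z\<bar> + \<bar>blinfun_apply ts y\<bar>))"

text \<open>
  A function on \<open>L\<close> is represented by its extension by \<open>0\<close>, so that equality of
  representatives is equality on \<open>L\<close> and the pointwise operations stay within the
  representatives.
\<close>

definition C_be ::
  "'a::real_normed_vector set \<Rightarrow> ('a \<Rightarrow> 'w::real_normed_vector) set" where
  "C_be L = {\<Phi>. (\<forall>u. u \<notin> L \<longrightarrow> \<Phi> u = 0) \<and> continuous_on L \<Phi> \<and> bounded (\<Phi> ` L) \<and>
                 (\<forall>u\<in>L. \<Phi> (- u) = \<Phi> u)}"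

definition sup_norm :: "'a set \<Rightarrow> ('a \<Rightarrow> 'w::real_normed_vector) \<Rightarrow> real" where
  "sup_norm L \<Phi> = (SUP u\<in>L. norm (\<Phi> u))"

definition function_subspace :: "('a \<Rightarrow> 'w::real_vector) set \<Rightarrow> bool" where
  "function_subspace Z \<longleftrightarrow>
     (\<lambda>u. 0) \<in> Z \<and>
     (\<forall>\<Phi>\<in>Z. \<forall>\<Psi>\<in>Z. (\<lambda>u. \<Phi> u + \<Psi> u) \<in> Z) \<and>
     (\<forall>c. \<forall>\<Phi>\<in>Z. (\<lambda>u. c *\<^sub>R \<Phi> u) \<in> Z)"

definition norm_on :: "('a \<Rightarrow> 'w::real_vector) set \<Rightarrow> (('a \<Rightarrow> 'w) \<Rightarrow> real) \<Rightarrow> bool" where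
  "norm_on Z N \<longleftrightarrow>
     (\<forall>\<Phi>\<in>Z. 0 \<le> N \<Phi> \<and> (N \<Phi> = 0 \<longleftrightarrow> \<Phi> = (\<lambda>u. 0))) \<and>
     (\<forall>\<Phi>\<in>Z. \<forall>\<Psi>\<in>Z. N (\<lambda>u. \<Phi> u + \<Psi> u) \<le> N \<Phi> + N \<Psi>) \<and>
     (\<forall>c. \<forall>\<Phi>\<in>Z. N (\<lambda>u. c *\<^sub>R \<Phi> u) = \<bar>c\<bar> * N \<Phi>)"

text \<open>
  The value \<open>0\<close> off \<open>Z\<close> is there because the library's metric spaces require the distance
  function to be nonnegative and symmetric on the whole type.
\<close>

definition norm_metric ::
  "('a \<Rightarrow> 'w::real_vector) set \<Rightarrow> (('a \<Rightarrow> 'w) \<Rightarrow> real) \<Rightarrow> ('a \<Rightarrow> 'w) metric" where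
  "norm_metric Z N =
     metric (Z, \<lambda>\<Phi> \<Psi>. if \<Phi> \<in> Z \<and> \<Psi> \<in> Z then N (\<lambda>u. \<Phi> u - \<Psi> u) else 0)"

lemma function_subspace_diff:
  assumes "function_subspace Z" "\<Phi> \<in> Z" "\<Psi> \<in> Z"
  shows "(\<lambda>u. \<Phi> u - \<Psi> u) \<in> Z"
proof -
  have add: "(\<lambda>u. f u + g u) \<in> Z" if "f \<in> Z" "g \<in> Z" for f g
    using assms(1) that by (simp add: function_subspace_def)
  have scale: "(\<lambda>u. c *\<^sub>R f u) \<in> Z" if "f \<in> Z" for c f
    using assms(1) that by (simp add: function_subspace_def)
  show ?thesis
    using add[OF assms(2) scale[OF assms(3), of "- 1"]] by simp
qed

lemma Metric_space_norm_metric: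
  assumes Z: "function_subspace Z" and N: "norm_on Z N"
  shows "Metric_space Z (\<lambda>\<Phi> \<Psi>. if \<Phi> \<in> Z \<and> \<Psi> \<in> Z then N (\<lambda>u. \<Phi> u - \<Psi> u) else 0)"
proof
  note diff = function_subspace_diff[OF Z]
  have add: "N (\<lambda>u. f u + g u) \<le> N f + N g" if "f \<in> Z" "g \<in> Z" for f g
    using N that by (simp add: norm_on_def)
  have scale: "N (\<lambda>u. c *\<^sub>R f u) = \<bar>c\<bar> * N f" if "f \<in> Z" for c f
    using N that by (simp add: norm_on_def)
  fix \<Phi> \<Psi> \<Theta> :: "'a \<Rightarrow> 'b"
  show "0 \<le> (if \<Phi> \<in> Z \<and> \<Psi> \<in> Z then N (\<lambda>u. \<Phi> u - \<Psi> u) else 0)"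
    using N diff by (simp add: norm_on_def)
  show "(if \<Phi> \<in> Z \<and> \<Psi> \<in> Z then N (\<lambda>u. \<Phi> u - \<Psi> u) else 0) =
        (if \<Psi> \<in> Z \<and> \<Phi> \<in> Z then N (\<lambda>u. \<Psi> u - \<Phi> u) else 0)"
  proof (cases "\<Phi> \<in> Z \<and> \<Psi> \<in> Z")
    case True
    then show ?thesis
      using scale[OF diff[of \<Phi> \<Psi>], of "- 1"] by simp
  qed auto
  show "(if \<Phi> \<in> Z \<and> \<Psi> \<in> Z then N (\<lambda>u. \<Phi> u - \<Psi> u) else 0) = 0 \<longleftrightarrow> \<Phi> = \<Psi>"
    if "\<Phi> \<in> Z" "\<Psi> \<in> Z"
    using N diff[OF that] that by (auto simp: norm_on_def fun_eq_iff)
  show "(if \<Phi> \<in> Z \<and> \<Theta> \<in> Z then N (\<lambda>u. \<Phi> u - \<Theta> u) else 0) \<le>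
        (if \<Phi> \<in> Z \<and> \<Psi> \<in> Z then N (\<lambda>u. \<Phi> u - \<Psi> u) else 0) +
        (if \<Psi> \<in> Z \<and> \<Theta> \<in> Z then N (\<lambda>u. \<Psi> u - \<Theta> u) else 0)"
    if "\<Phi> \<in> Z" "\<Psi> \<in> Z" "\<Theta> \<in> Z"
    using add[OF diff[of \<Phi> \<Psi>] diff[of \<Psi> \<Theta>]] that by simp
qed

definition banach_included_in ::
  "('a \<Rightarrow> 'w::real_vector) set \<Rightarrow> (('a \<Rightarrow> 'w) \<Rightarrow> real) \<Rightarrow> ('a \<Rightarrow> 'w) set \<Rightarrow> bool" where
  "banach_included_in Z N C \<longleftrightarrow>
     Z \<subseteq> C \<and> function_subspace Z \<and> norm_on Z N \<and> mcomplete_of (norm_metric Z N)"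

definition finite_rank ::
  "('x::real_normed_vector \<Rightarrow>\<^sub>L 'y::real_normed_vector) set" where
  "finite_rank = {T. \<exists>B. finite B \<and> range (blinfun_apply T) \<subseteq> span B}"

text \<open>The restriction of \<open>(x, y\<^sup>*) \<mapsto> y\<^sup>*(T x) w\<close> to \<open>L\<close>, in the above representation.\<close>

definition op_oplus ::
  "('x::real_normed_vector \<times> ('y::real_normed_vector \<Rightarrow>\<^sub>L real)) set \<Rightarrow> ('x \<Rightarrow>\<^sub>L 'y) \<Rightarrow>
   'w::real_vector \<Rightarrow> 'x \<times> ('y \<Rightarrow>\<^sub>L real) \<Rightarrow> 'w" where
  "op_oplus L T w = (\<lambda>(x, ys). if (x, ys) \<in> L
     then blinfun_apply ys (blinfun_apply T x) *\<^sub>R w else 0)"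

definition attains_strongly ::
  "('a::real_normed_vector \<times> 'b::real_normed_vector) set \<Rightarrow>
   ('a \<times> 'b \<Rightarrow> 'w::real_normed_vector) \<Rightarrow> bool" where
  "attains_strongly L \<Phi> \<longleftrightarrow>
     (\<exists>u\<^sub>0\<in>L. norm (\<Phi> u\<^sub>0) = (SUP u\<in>L. norm (\<Phi> u)) \<and>
       (\<forall>u :: nat \<Rightarrow> 'a \<times> 'b. (\<forall>n. u n \<in> L) \<and>
          (\<lambda>n. norm (\<Phi> (u n))) \<longlonglongrightarrow> (SUP u\<in>L. norm (\<Phi> u)) \<longrightarrow>
          (\<lambda>n. d_H (Gam (u n)) (Gam u\<^sub>0)) \<longlonglongrightarrow> 0))"

definition porous :: "'a metric \<Rightarrow> 'a set \<Rightarrow> bool" where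
  "porous m A \<longleftrightarrow> A \<subseteq> mspace m \<and>
     (\<exists>l\<^sub>0 r\<^sub>0. 0 < l\<^sub>0 \<and> l\<^sub>0 \<le> 1 \<and> 0 < r\<^sub>0 \<and>
       (\<forall>x\<in>mspace m. \<forall>r. 0 < r \<and> r \<le> r\<^sub>0 \<longrightarrow>
         (\<exists>y\<in>mspace m. mball_of m y (l\<^sub>0 * r) \<subseteq> mball_of m x r \<inter> (mspace m - A))))"

definition sigma_porous :: "'a metric \<Rightarrow> 'a set \<Rightarrow> bool" where
  "sigma_porous m A \<longleftrightarrow> (\<exists>\<A>. countable \<A> \<and> (\<forall>B\<in>\<A>. porous m B) \<and> A = \<Union>\<A>)"

end

theory Submission
  imports Defs
begin

text \<open>
  Adding a small function that peaks sharply at an almost maximal point forces the maximum of the norm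
  into a small neighbourhood of that point, and property \<open>(P)\<close> is what supplies such peak functions from
  finite rank operators.

  For \<open>(x0, ys0) \<in> L\<close> property \<open>(P)\<close> gives \<open>xs\<close> and \<open>y\<close> in the unit balls such that \<open>xs x + ys y\<close> separates
  \<open>(x0, ys0)\<close>, by a margin uniform in the point, from all points of \<open>L\<close> that are \<open>d_H\<close>-far from it.
  With \<open>xs0\<close> norming \<open>x0\<close> (Hahn--Banach) and \<open>y0\<close> almost norming \<open>ys0\<close>, the average of the
  rank one operators \<open>xs \<otimes> y0\<close> and \<open>xs0 \<otimes> y\<close> turns this sum into a bilinear expression with the same
  kind of margin, and that expression peaks at \<open>(x0, ys0)\<close> (\<open>property_P_peak_operators\<close>).

  Say that \<open>G\<close> peaks at the scale \<open>\<epsilon>\<close> if some point of \<open>L\<close> beats all points at \<open>d_H\<close>-distance at least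
  \<open>\<epsilon>\<close> by a positive margin. A function that peaks at all scales attains its maximum strongly
  (\<open>attains_strongly_if_peaks\<close>). For fixed \<open>\<epsilon>\<close>, a perturbation of size comparable to \<open>r\<close> by a peak function
  in the direction of the value at an almost maximal point makes \<open>\<Theta> + \<Phi>\<close> peak, with a margin
  proportional to \<open>r\<close>, and a whole ball of radius proportional to \<open>r\<close> inherits this. So the functions not
  peaking at the scale \<open>\<epsilon>\<close> form a porous set (\<open>porous_non_peaking\<close>), and the scales \<open>1 / (n + 1)\<close> give the first
  assertion.

  For the second assertion the peak function is added at the given point, where \<open>\<Phi>\<close> is almost
  maximal. Baire's theorem then gives a nearby norm attaining function, which
  can attain its norm only near that point.
\<close>

section \<open>Norming functionals\<close>

definition sublinear :: "('a::real_vector \<Rightarrow> real) \<Rightarrow> bool" where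
  "sublinear q \<longleftrightarrow>
     (\<forall>x y. q (x + y) \<le> q x + q y) \<and> (\<forall>c x. 0 < c \<longrightarrow> q (c *\<^sub>R x) = c * q x)"

lemma sublinearI:
  assumes add: "\<And>x y. q (x + y) \<le> q x + q y"
    and scale: "\<And>c x. 0 < c \<Longrightarrow> q (c *\<^sub>R x) \<le> c * q x"
  shows "sublinear q"
proof -
  have "c * q x \<le> q (c *\<^sub>R x)" if "0 < c" for c x
    using scale[of "inverse c" "c *\<^sub>R x"] that by (simp add: field_simps)
  then show ?thesis
    unfolding sublinear_def using add scale by (meson antisym)
qed

lemma sublinear_0:
  assumes "sublinear q"
  shows "q 0 = 0"
proof -
  have "q (2 *\<^sub>R 0) = 2 * q 0"
    using assms unfolding sublinear_def by (metis zero_less_numeral)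
  then show ?thesis by simp
qed

lemma sublinear_lower_bound:
  assumes "sublinear q" "\<And>x. q x \<le> p x"
  shows "- p (- x) \<le> q x"
proof -
  have "q (x + - x) \<le> q x + q (- x)"
    using assms(1) unfolding sublinear_def by blast
  then show ?thesis
    using sublinear_0[OF assms(1)] assms(2)[of "- x"] by simp
qed

text \<open>
  The infimum of \<open>p (x + t a) - t p a\<close> over \<open>t \<ge> 0\<close> tests additivity of \<open>p\<close> in the direction \<open>a\<close>:
  a linear \<open>p\<close> is unchanged, and any other \<open>p\<close> drops for some \<open>a\<close>. So this one construction shows both
  that a minimal sublinear function is additive and that, starting from the norm, a linear
  function below the result has to norm \<open>a\<close>. The infimum is finite since \<open>- p (- x)\<close> bounds it below.
\<close>

lemma sublinear_push_down:
  assumes p: "sublinear p"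
  shows "\<exists>q. sublinear q \<and> (\<forall>x. q x \<le> p x) \<and> (\<forall>x. q x \<le> p (x + a) - p a)"
proof -
  define h where "h x t = p (x + t *\<^sub>R a) - t * p a" for x t
  define q where "q x = (INF t\<in>{0..}. h x t)" for x
  have add: "p (x + y) \<le> p x + p y" for x y
    using p unfolding sublinear_def by blast
  have scale: "p (c *\<^sub>R x) = c * p x" if "0 \<le> c" for c x
    using p that sublinear_0[OF p] unfolding sublinear_def by (cases "c = 0") auto
  have lower: "- p (- x) \<le> h x t" if "0 \<le> t" for x t
    using add[of "x + t *\<^sub>R a" "- x"] scale[OF that, of a] by (simp add: h_def)
  have bdd: "bdd_below (h x ` {0..})" for x
    using lower by (intro bdd_belowI2[where m = "- p (- x)"]) auto
  have q_le: "q x \<le> h x t" if "0 \<le> t" for x t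
    unfolding q_def using that by (intro cINF_lower[OF bdd]) auto
  have q_greatest: "b \<le> q x" if "\<And>t. 0 \<le> t \<Longrightarrow> b \<le> h x t" for b x
    unfolding q_def using that by (intro cINF_greatest) auto
  have "sublinear q"
  proof (rule sublinearI)
    fix x y
    have "q (x + y) \<le> h x s + h y t" if "0 \<le> s" "0 \<le> t" for s t
    proof -
      have "q (x + y) \<le> h (x + y) (s + t)"
        using that by (intro q_le) auto
      also have "\<dots> \<le> h x s + h y t"
        using add[of "x + s *\<^sub>R a" "y + t *\<^sub>R a"] by (simp add: h_def algebra_simps)
      finally show ?thesis .
    qed
    then have "q (x + y) - h y t \<le> q x" if "0 \<le> t" for t
      using that by (intro q_greatest) (simp add: diff_le_eq)
    then have "q (x + y) - q x \<le> q y"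
      by (intro q_greatest) (smt (verit))
    then show "q (x + y) \<le> q x + q y" by simp
  next
    fix c :: real and x
    assume c: "0 < c"
    have "q (c *\<^sub>R x) / c \<le> h x t" if "0 \<le> t" for t
    proof -
      have "q (c *\<^sub>R x) \<le> h (c *\<^sub>R x) (c * t)"
        using c that by (intro q_le) simp
      also have "\<dots> = c * h x t"
        using scale[of c "x + t *\<^sub>R a"] c by (simp add: h_def algebra_simps)
      finally show ?thesis
        using c by (simp add: field_simps)
    qed
    then have "q (c *\<^sub>R x) / c \<le> q x"
      by (rule q_greatest)
    then show "q (c *\<^sub>R x) \<le> c * q x"
      using c by (simp add: field_simps)
  qed
  moreover have "q x \<le> p x" "q x \<le> p (x + a) - p a" for x
    using q_le[of 0 x] q_le[of 1 x] by (simp_all add: h_def)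
  ultimately show ?thesis by blast
qed

text \<open>
  For subadditivity the values of two members \<open>q\<close> at \<open>x\<close> and \<open>r\<close> at \<open>y\<close> have to be compared with one member at
  \<open>x + y\<close>; in a chain the smaller of \<open>q\<close> and \<open>r\<close> serves.
\<close>

lemma sublinear_INF_chain:
  fixes C :: "('a::real_vector \<Rightarrow> real) set"
  assumes ne: "C \<noteq> {}" and sub: "\<And>q. q \<in> C \<Longrightarrow> sublinear q"
    and le: "\<And>q. q \<in> C \<Longrightarrow> q \<le> p"
    and chain: "\<And>q r. q \<in> C \<Longrightarrow> r \<in> C \<Longrightarrow> q \<le> r \<or> r \<le> q"
  shows "sublinear (\<lambda>x. INF q\<in>C. q x)" and "q \<in> C \<Longrightarrow> (INF q\<in>C. q x) \<le> q x"
proof -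
  define u where "u x = (INF q\<in>C. q x)" for x
  have bdd: "bdd_below ((\<lambda>q. q x) ` C)" for x
  proof (rule bdd_belowI2)
    show "- p (- x) \<le> q x" if "q \<in> C" for q
      using sub le that by (intro sublinear_lower_bound) (auto simp: le_fun_def)
  qed
  have u_le: "u x \<le> q x" if "q \<in> C" for q x
    unfolding u_def using that by (rule cINF_lower[OF bdd])
  have u_greatest: "b \<le> u x" if "\<And>q. q \<in> C \<Longrightarrow> b \<le> q x" for b x
    unfolding u_def using ne that by (intro cINF_greatest) auto
  have "sublinear u"
  proof (rule sublinearI)
    fix x y
    have "u (x + y) \<le> q x + r y" if "q \<in> C" "r \<in> C" for q r
    proof -
      have "\<exists>m\<in>C. m \<le> q \<and> m \<le> r"
        using chain[OF that] that by blast
      then obtain m where m: "m \<in> C" "m x \<le> q x" "m y \<le> r y"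
        by (auto simp: le_fun_def)
      have "u (x + y) \<le> m (x + y)"
        by (rule u_le[OF m(1)])
      also have "\<dots> \<le> m x + m y"
        using sub[OF m(1)] unfolding sublinear_def by blast
      finally show ?thesis using m by linarith
    qed
    then have "u (x + y) - r y \<le> u x" if "r \<in> C" for r
      using that by (intro u_greatest) (simp add: diff_le_eq)
    then have "u (x + y) - u x \<le> u y"
      by (intro u_greatest) (smt (verit))
    then show "u (x + y) \<le> u x + u y" by simp
  next
    fix c :: real and x
    assume c: "0 < c"
    have "u (c *\<^sub>R x) / c \<le> q x" if "q \<in> C" for q
      using u_le[OF that, of "c *\<^sub>R x"] sub[OF that] c
      unfolding sublinear_def by (simp add: field_simps)
    then have "u (c *\<^sub>R x) / c \<le> u x"
      by (rule u_greatest)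
    then show "u (c *\<^sub>R x) \<le> c * u x"
      using c by (simp add: field_simps)
  qed
  then show "sublinear (\<lambda>x. INF q\<in>C. q x)"
    unfolding u_def .
  show "(INF q\<in>C. q x) \<le> q x" if "q \<in> C"
    using u_le[OF that] unfolding u_def .
qed

text \<open>
  The Hahn--Banach theorem. Zorn's lemma is applied to the sublinear functions below \<open>p\<close> rather than
  to partial linear functionals, so that no domains occur: a minimal element \<open>q\<close> coincides with each of
  its modifications by \<open>sublinear_push_down\<close>, whence \<open>q x + q a \<le> q (x + a)\<close>.
\<close>

lemma linear_below_sublinear:
  assumes p: "sublinear p"
  shows "\<exists>f. linear f \<and> (\<forall>x. f x \<le> p x)"
proof -
  define A where "A = {q. sublinear q \<and> q \<le> p}"
  have "\<exists>q\<in>A. \<forall>r\<in>A. r \<le> q \<longrightarrow> r = q"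
  proof (rule predicate_Zorn)
    show "partial_order_on A (relation_of (\<lambda>q r. r \<le> q) A)"
      by (rule partial_order_on_relation_ofI) auto
    fix C
    assume C: "C \<in> Chains (relation_of (\<lambda>q r. r \<le> q) A)"
    then have CA: "C \<subseteq> A"
      by (auto simp: Chains_def relation_of_def)
    have chain: "q \<le> r \<or> r \<le> q" if "q \<in> C" "r \<in> C" for q r
      using C that by (auto simp: Chains_def relation_of_def)
    show "\<exists>u\<in>A. \<forall>q\<in>C. u \<le> q"
    proof (cases "C = {}")
      case True
      then show ?thesis using p by (auto simp: A_def)
    next
      case False
      have C': "sublinear q" "q \<le> p" if "q \<in> C" for q
        using CA that by (auto simp: A_def)
      define u where "u x = (INF q\<in>C. q x)" for x
      note inf = sublinear_INF_chain[where C = C and p = p, OF False C' chain, folded u_def]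
      have le: "u x \<le> q x" if "q \<in> C" for q x
        using inf(2) that by blast
      obtain q where "q \<in> C"
        using False by blast
      then have "u x \<le> p x" for x
        using le[of q x] le_funD[OF C'(2), of q x] by linarith
      then have "u \<in> A"
        using inf(1) by (simp add: A_def le_fun_def)
      then show ?thesis
        using le by (auto simp: le_fun_def)
    qed
  qed
  then obtain q where "q \<in> A" and minA: "\<And>r. r \<in> A \<Longrightarrow> r \<le> q \<Longrightarrow> r = q"
    by blast
  then have q: "sublinear q" "q \<le> p"
    by (auto simp: A_def)
  have min: "r = q" if "sublinear r" "r \<le> q" for r
    using that q(2) by (intro minA) (auto simp: A_def intro: order_trans[of r q p])
  have add: "q (x + y) = q x + q y" for x y
  proof -
    obtain r where r: "sublinear r" "r \<le> q" "\<And>x. r x \<le> q (x + y) - q y"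
      using sublinear_push_down[OF q(1), of y] by (auto simp: le_fun_def)
    then have "q x \<le> q (x + y) - q y"
      using min by metis
    moreover have "q (x + y) \<le> q x + q y"
      using q(1) unfolding sublinear_def by blast
    ultimately show ?thesis by simp
  qed
  have minus: "q (- x) = - q x" for x
    using add[of x "- x"] sublinear_0[OF q(1)] by simp
  have pos: "q (c *\<^sub>R x) = c * q x" if "0 \<le> c" for c x
    using q(1) that sublinear_0[OF q(1)] unfolding sublinear_def by (cases "c = 0") auto
  have "q (c *\<^sub>R x) = c * q x" for c x
    using pos[of c x] pos[of "- c" x] minus[of "c *\<^sub>R x"] by (cases "0 \<le> c") auto
  then have "linear q"
    by (intro linearI) (auto simp: add)
  then show ?thesis
    using q(2) by (auto simp: le_fun_def)
qed

lemma norming_functional: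
  fixes a :: "'a::real_normed_vector"
  shows "\<exists>f :: 'a \<Rightarrow>\<^sub>L real. norm f \<le> 1 \<and> blinfun_apply f a = norm a"
proof -
  have "sublinear (norm :: 'a \<Rightarrow> real)"
    by (rule sublinearI) (auto simp: norm_triangle_ineq)
  then obtain p where p: "sublinear p" "\<And>x. p x \<le> norm x" "\<And>x. p x \<le> norm (x + a) - norm a"
    using sublinear_push_down[of norm a] by auto
  \<comment> \<open>At \<open>- a\<close> the second bound on \<open>p\<close> reads \<open>p (- a) \<le> - norm a\<close>, which forces \<open>f a = norm a\<close>.\<close>
  obtain f where f: "linear f" and fp: "\<And>x. f x \<le> p x"
    using linear_below_sublinear[OF p(1)] by auto
  have le: "f x \<le> norm x" for x
    using fp[of x] p(2)[of x] by linarith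
  have abs: "\<bar>f x\<bar> \<le> norm x" for x
    using le[of x] le[of "- x"] linear_neg[OF f, of x] by simp
  have "bounded_linear f"
    using f abs by (intro bounded_linear.intro bounded_linear_axioms.intro exI[of _ 1]) auto
  moreover have "f a = norm a"
    using fp[of "- a"] p(3)[of "- a"] le[of a] linear_neg[OF f, of a] by simp
  ultimately show ?thesis
    using abs by (intro exI[of _ "Blinfun f"] conjI norm_blinfun_bound)
      (auto simp: bounded_linear_Blinfun_apply)
qed

lemma nearly_norming_vector:
  fixes f :: "'a::real_normed_vector \<Rightarrow>\<^sub>L real"
  assumes "0 < \<delta>" "norm f = 1"
  shows "\<exists>y\<in>cball 0 1. 1 - \<delta> \<le> blinfun_apply f y"
proof (rule ccontr)
  assume "\<not> ?thesis"
  then have less: "blinfun_apply f y < 1 - \<delta>" if "norm y \<le> 1" for y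
    using that by force
  have abs: "\<bar>blinfun_apply f y\<bar> \<le> 1 - \<delta>" if "norm y \<le> 1" for y
    using less[of y] less[of "- y"] that by (simp add: blinfun.minus_right)
  have "norm (blinfun_apply f y) \<le> (1 - \<delta>) * norm y" for y
    using abs[of "sgn y"]
    by (cases "y = 0") (auto simp: sgn_div_norm blinfun.scaleR_right abs_mult field_simps)
  moreover have "0 \<le> 1 - \<delta>"
    using less[of 0] by simp
  ultimately have "norm f \<le> 1 - \<delta>"
    by (intro norm_blinfun_bound)
  then show False using assms by simp
qed

section \<open>Peak functions from finite rank operators\<close>

definition rank_one :: "('x::real_normed_vector \<Rightarrow>\<^sub>L real) \<Rightarrow> 'y::real_normed_vector \<Rightarrow> 'x \<Rightarrow>\<^sub>L 'y" where
  "rank_one f y = blinfun_scaleR_left y o\<^sub>L f"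

lemma rank_one_apply [simp]: "blinfun_apply (rank_one f y) x = blinfun_apply f x *\<^sub>R y"
  by (simp add: rank_one_def)

lemma norm_rank_one_le: "norm (rank_one f y) \<le> norm f * norm y"
proof (rule norm_blinfun_bound)
  show "norm (blinfun_apply (rank_one f y) x) \<le> norm f * norm y * norm x" for x
    using mult_right_mono[OF norm_blinfun[of f x], of "norm y"] by (simp add: mult_ac)
qed auto

definition pairing :: "('x::real_normed_vector \<Rightarrow>\<^sub>L 'y::real_normed_vector) \<Rightarrow>
    'x \<times> ('y \<Rightarrow>\<^sub>L real) \<Rightarrow> real" where
  "pairing T u = blinfun_apply (snd u) (blinfun_apply T (fst u))"

lemma abs_functional_le_1:
  fixes f :: "'a::real_normed_vector \<Rightarrow>\<^sub>L real"
  assumes "norm f \<le> 1" "norm v \<le> 1"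
  shows "\<bar>blinfun_apply f v\<bar> \<le> 1"
  using norm_blinfun[of f v] mult_mono[OF assms] by simp

text \<open>
  Property \<open>(P)\<close> provides a separating sum \<open>xs x + ys y\<close>, whereas a finite rank operator gives
  functions bilinear in \<open>(x, ys)\<close>. The product \<open>xs x * ys y\<close> coming from one rank one operator is no
  substitute: it can vanish at the base point although the sum is large. Pairing each
  summand with a factor that is almost \<open>1\<close> at the base point and at most \<open>1\<close> elsewhere repairs this:
  \<open>xs x * ys y0 + xs0 x * ys y\<close>, where \<open>xs0\<close> norms \<open>x0\<close> and \<open>y0\<close> almost norms \<open>ys0\<close>.
\<close>

lemma peak_operator_bound:
  fixes x0 :: "'x::real_normed_vector" and ys0 :: "'y::real_normed_vector \<Rightarrow>\<^sub>L real"
  assumes unit: "norm x0 = 1" "norm ys0 = 1" and xs: "norm xs \<le> 1" and y: "norm y \<le> 1"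
    and "0 < \<omega>"
  shows "\<exists>T\<in>finite_rank. norm T \<le> 1 \<and>
    (blinfun_apply xs x0 + blinfun_apply ys0 y) / 2 - \<omega> \<le> pairing T (x0, ys0) \<and>
    (\<forall>z ts. norm z \<le> 1 \<longrightarrow> norm ts \<le> 1 \<longrightarrow>
      \<bar>pairing T (z, ts)\<bar> \<le> (\<bar>blinfun_apply xs z\<bar> + \<bar>blinfun_apply ts y\<bar>) / 2)"
proof -
  obtain xs0 :: "'x \<Rightarrow>\<^sub>L real" where xs0: "norm xs0 \<le> 1" "blinfun_apply xs0 x0 = 1"
    using norming_functional[of x0] unit by metis
  obtain y0 where y0: "norm y0 \<le> 1" "1 - \<omega> \<le> blinfun_apply ys0 y0"
    using nearly_norming_vector[of \<omega> ys0] assms by auto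
  define T where "T = (1/2) *\<^sub>R (rank_one xs y0 + rank_one xs0 y)"
  have T: "pairing T (z, ts) = (blinfun_apply xs z * blinfun_apply ts y0 +
      blinfun_apply xs0 z * blinfun_apply ts y) / 2" for z ts
    by (simp add: pairing_def T_def blinfun.bilinear_simps)
  have "range (blinfun_apply T) \<subseteq> span {y0, y}"
  proof (rule image_subsetI)
    fix x
    have "(1/2) *\<^sub>R (blinfun_apply xs x *\<^sub>R y0 + blinfun_apply xs0 x *\<^sub>R y) \<in> span {y0, y}"
      by (rule span_scale, rule span_add; rule span_scale, rule span_base, simp)
    then show "blinfun_apply T x \<in> span {y0, y}"
      by (simp only: T_def blinfun.scaleR_left blinfun.add_left rank_one_apply)
  qed
  then have "T \<in> finite_rank"
    unfolding finite_rank_def by (intro CollectI exI[of _ "{y0, y}"] conjI) auto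
  moreover have "norm T \<le> 1"
  proof -
    have "norm (rank_one xs y0) \<le> 1" "norm (rank_one xs0 y) \<le> 1"
      using norm_rank_one_le[of xs y0] norm_rank_one_le[of xs0 y]
        mult_mono[OF xs y0(1)] mult_mono[OF xs0(1) y] by auto
    then show ?thesis
      using norm_triangle_ineq[of "rank_one xs y0" "rank_one xs0 y"] by (simp add: T_def)
  qed
  moreover have "(blinfun_apply xs x0 + blinfun_apply ys0 y) / 2 - \<omega> \<le> pairing T (x0, ys0)"
  proof -
    define a b where "a = blinfun_apply xs x0" and "b = blinfun_apply ys0 y0"
    have "\<bar>a\<bar> \<le> 1" "\<bar>b\<bar> \<le> 1" "1 - \<omega> \<le> b"
      unfolding a_def b_def using unit xs y0 by (auto intro!: abs_functional_le_1)
    then have "a * (1 - b) \<le> 1 * (1 - b)"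
      by (intro mult_right_mono) auto
    then have "a - \<omega> \<le> a * b"
      using \<open>1 - \<omega> \<le> b\<close> by (simp add: algebra_simps)
    then show ?thesis
      using \<open>0 < \<omega>\<close> by (simp add: T xs0(2) a_def b_def field_simps)
  qed
  moreover have "\<bar>pairing T (z, ts)\<bar> \<le> (\<bar>blinfun_apply xs z\<bar> + \<bar>blinfun_apply ts y\<bar>) / 2"
    if "norm z \<le> 1" "norm ts \<le> 1" for z ts
  proof -
    have "\<bar>blinfun_apply xs z * blinfun_apply ts y0\<bar> \<le> \<bar>blinfun_apply xs z\<bar> * 1"
      unfolding abs_mult using y0(1) that by (intro mult_left_mono abs_functional_le_1) auto
    moreover have "\<bar>blinfun_apply xs0 z * blinfun_apply ts y\<bar> \<le> 1 * \<bar>blinfun_apply ts y\<bar>"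
      unfolding abs_mult using xs0(1) that by (intro mult_right_mono abs_functional_le_1) auto
    ultimately show ?thesis
      using abs_triangle_ineq[of "blinfun_apply xs z * blinfun_apply ts y0"
          "blinfun_apply xs0 z * blinfun_apply ts y"]
      unfolding T by simp
  qed
  ultimately show ?thesis by blast
qed

text \<open>
  Here \<open>\<epsilon>\<close> need not be small, because the condition weakens as \<open>\<epsilon>\<close> grows.
  Half of the separation \<open>\<omega>\<close> is left after averaging the two rank one parts, and half of that
  pays for \<open>y0\<close> being only almost norming.
\<close>

lemma property_P_peak_operators:
  fixes L :: "('x::real_normed_vector \<times> ('y::real_normed_vector \<Rightarrow>\<^sub>L real)) set"
  assumes P: "property_P L" and L: "L \<subseteq> sphere 0 1 \<times> sphere 0 1" and "0 < \<epsilon>"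
  shows "\<exists>\<rho>>0. \<forall>u\<in>L. \<exists>T\<in>finite_rank. norm T \<le> 1 \<and>
    (\<forall>v\<in>L. \<epsilon> \<le> d_H (Gam u) (Gam v) \<longrightarrow> \<bar>pairing T v\<bar> + \<rho> \<le> pairing T u)"
proof -
  obtain \<epsilon>0 where "0 < \<epsilon>0" and small: "\<And>e. 0 < e \<and> e < \<epsilon>0 \<Longrightarrow>
       \<exists>\<omega>>0. \<forall>(x, ys) \<in> L.
         \<exists>(xs :: 'x \<Rightarrow>\<^sub>L real) \<in> cball 0 1. \<exists>y \<in> cball 0 1.
           \<forall>(z, ts) \<in> L. d_H (Gam (x, ys)) (Gam (z, ts)) \<ge> e \<longrightarrow>
             blinfun_apply xs x + blinfun_apply ys y - \<omega>
               \<ge> \<bar>blinfun_apply xs z\<bar> + \<bar>blinfun_apply ts y\<bar>"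
    using P unfolding property_P_def by blast
  define e where "e = min \<epsilon> (\<epsilon>0 / 2)"
  have e: "0 < e \<and> e < \<epsilon>0" "e \<le> \<epsilon>"
    using \<open>0 < \<epsilon>\<close> \<open>0 < \<epsilon>0\<close> by (auto simp: e_def)
  obtain \<omega> where "0 < \<omega>" and \<omega>: "\<And>x ys. (x, ys) \<in> L \<Longrightarrow>
         \<exists>(xs :: 'x \<Rightarrow>\<^sub>L real) \<in> cball 0 1. \<exists>y \<in> cball 0 1.
           \<forall>(z, ts) \<in> L. d_H (Gam (x, ys)) (Gam (z, ts)) \<ge> e \<longrightarrow>
             blinfun_apply xs x + blinfun_apply ys y - \<omega>
               \<ge> \<bar>blinfun_apply xs z\<bar> + \<bar>blinfun_apply ts y\<bar>"
    using small[OF e(1)] by blast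
  have "\<exists>T\<in>finite_rank. norm T \<le> 1 \<and>
      (\<forall>v\<in>L. \<epsilon> \<le> d_H (Gam u) (Gam v) \<longrightarrow> \<bar>pairing T v\<bar> + \<omega> / 4 \<le> pairing T u)"
    if "u \<in> L" for u
  proof -
    obtain x0 ys0 where u: "u = (x0, ys0)" by (cases u)
    obtain xs :: "'x \<Rightarrow>\<^sub>L real" and y where xs: "norm xs \<le> 1" and y: "norm y \<le> 1"
      and far: "\<And>z ts. (z, ts) \<in> L \<Longrightarrow> e \<le> d_H (Gam u) (Gam (z, ts)) \<Longrightarrow>
        \<bar>blinfun_apply xs z\<bar> + \<bar>blinfun_apply ts y\<bar> + \<omega>
          \<le> blinfun_apply xs x0 + blinfun_apply ys0 y"
    proof -
      obtain xs :: "'x \<Rightarrow>\<^sub>L real" and y where "xs \<in> cball 0 1" "y \<in> cball 0 1" and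
        *: "\<forall>(z, ts) \<in> L. d_H (Gam (x0, ys0)) (Gam (z, ts)) \<ge> e \<longrightarrow>
             blinfun_apply xs x0 + blinfun_apply ys0 y - \<omega>
               \<ge> \<bar>blinfun_apply xs z\<bar> + \<bar>blinfun_apply ts y\<bar>"
        using \<omega>[of x0 ys0] \<open>u \<in> L\<close> unfolding u by blast
      then have "norm xs \<le> 1" "norm y \<le> 1" by auto
      moreover have "\<bar>blinfun_apply xs z\<bar> + \<bar>blinfun_apply ts y\<bar> + \<omega>
          \<le> blinfun_apply xs x0 + blinfun_apply ys0 y"
        if "(z, ts) \<in> L" "e \<le> d_H (Gam u) (Gam (z, ts))" for z ts
        using bspec[OF * that(1)] that(2) by (simp add: u)
      ultimately show thesis
        using that by blast
    qed
    have "norm x0 = 1" "norm ys0 = 1"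
      using that L by (auto simp: u)
    from peak_operator_bound[OF this xs y, of "\<omega> / 4"] \<open>0 < \<omega>\<close>
    obtain T where T: "T \<in> finite_rank" "norm T \<le> 1"
      and at_u: "(blinfun_apply xs x0 + blinfun_apply ys0 y) / 2 - \<omega> / 4 \<le> pairing T u"
      and bound: "\<And>z ts. norm z \<le> 1 \<Longrightarrow> norm ts \<le> 1 \<Longrightarrow>
        \<bar>pairing T (z, ts)\<bar> \<le> (\<bar>blinfun_apply xs z\<bar> + \<bar>blinfun_apply ts y\<bar>) / 2"
      unfolding u by auto
    have "\<bar>pairing T v\<bar> + \<omega> / 4 \<le> pairing T u"
      if "v \<in> L" "\<epsilon> \<le> d_H (Gam u) (Gam v)" for v
    proof -
      obtain z ts where v: "v = (z, ts)" by (cases v)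
      have "norm z = 1" "norm ts = 1"
        using that(1) L by (auto simp: v)
      then show ?thesis
        using far[of z ts] bound[of z ts] at_u that e(2) by (simp add: v field_simps)
    qed
    with T show ?thesis by blast
  qed
  then show ?thesis
    using \<open>0 < \<omega>\<close> by (intro exI[of _ "\<omega> / 4"]) auto
qed

section \<open>The distance modulo sign\<close>

lemma d_H_Gam_sum_dist: "d_H (Gam u) (Gam v) = min (sum_dist u v) (sum_dist u (- v))"
  by (cases u; cases v) (simp add: d_H_Gam sum_dist_def)

lemma sum_dist_commute: "sum_dist u v = sum_dist v u"
  by (simp add: sum_dist_def norm_minus_commute)

lemma sum_dist_triangle: "sum_dist u w \<le> sum_dist u v + sum_dist v w"
  using norm_triangle_ineq[of "fst u - fst v" "fst v - fst w"]
    norm_triangle_ineq[of "snd u - snd v" "snd v - snd w"]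
  by (simp add: sum_dist_def)

lemma sum_dist_minus: "sum_dist (- u) (- v) = sum_dist u v"
  by (simp add: sum_dist_def norm_minus_commute)

lemma dist_le_sum_dist: "dist u v \<le> sum_dist u v"
  unfolding sum_dist_def dist_prod_def dist_norm by (rule sqrt_sum_squares_le_sum) auto

lemma d_H_Gam_commute: "d_H (Gam u) (Gam v) = d_H (Gam v) (Gam u)"
  using sum_dist_minus[of u "- v"] unfolding d_H_Gam_sum_dist
  by (simp add: sum_dist_commute)

lemma d_H_Gam_triangle: "d_H (Gam u) (Gam w) \<le> d_H (Gam u) (Gam v) + d_H (Gam v) (Gam w)"
  using sum_dist_triangle[of u w v] sum_dist_triangle[of u "- w" v]
    sum_dist_triangle[of u w "- v"] sum_dist_triangle[of u "- w" "- v"]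
    sum_dist_minus[of v w] sum_dist_minus[of v "- w"]
  unfolding d_H_Gam_sum_dist by (simp add: min_def)

lemma d_H_Gam_nonneg: "0 \<le> d_H (Gam u) (Gam v)"
  by (simp add: d_H_Gam_sum_dist sum_dist_def)

section \<open>Peaking at a scale and strong attainment\<close>

lemma C_be_norm_le_sup:
  assumes "G \<in> C_be L"
  shows "bdd_above ((\<lambda>u. norm (G u)) ` L)"
    and "u \<in> L \<Longrightarrow> norm (G u) \<le> sup_norm L G"
proof -
  show *: "bdd_above ((\<lambda>u. norm (G u)) ` L)"
    using assms unfolding C_be_def bounded_iff by (auto intro: bdd_aboveI2)
  show "norm (G u) \<le> sup_norm L G" if "u \<in> L"
    unfolding sup_norm_def using that * by (rule cSUP_upper)
qed

lemma C_be_nearly_maximal_point: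
  assumes "G \<in> C_be L" "L \<noteq> {}" "c < sup_norm L G"
  shows "\<exists>u\<in>L. c < norm (G u)"
  using assms less_cSUP_iff[OF assms(2) C_be_norm_le_sup(1)[OF assms(1)]]
  by (auto simp: sup_norm_def)

text \<open>
  A quantitative, stable form of strong attainment at the scale \<open>\<epsilon>\<close>: the point \<open>u\<close> need not be a
  maximum, but it beats everything outside its \<open>\<epsilon>\<close>-neighbourhood by a fixed margin, and a
  small uniform perturbation only reduces the margin.
\<close>

definition peaks_within ::
  "('a::real_normed_vector \<times> 'b::real_normed_vector) set \<Rightarrow> real \<Rightarrow>
   ('a \<times> 'b \<Rightarrow> 'w::real_normed_vector) \<Rightarrow> bool" where
  "peaks_within L \<epsilon> G \<longleftrightarrow>
     (\<exists>u\<in>L. \<exists>\<sigma>>0. \<forall>v\<in>L. \<epsilon> \<le> d_H (Gam u) (Gam v) \<longrightarrow> norm (G v) + \<sigma> \<le> norm (G u))"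

lemma peaks_within_mono:
  assumes "peaks_within L \<delta> G" "\<delta> \<le> \<epsilon>"
  shows "peaks_within L \<epsilon> G"
  using assms unfolding peaks_within_def by (meson order_trans)

lemma peaks_within_near_maximal_diameter:
  assumes G: "G \<in> C_be L" and peaks: "peaks_within L (\<epsilon> / 2) G"
  shows "\<exists>c < sup_norm L G. \<forall>v\<in>L. \<forall>w\<in>L.
    c < norm (G v) \<longrightarrow> c < norm (G w) \<longrightarrow> d_H (Gam v) (Gam w) < \<epsilon>"
proof -
  obtain u \<sigma> where u: "u \<in> L" "0 < \<sigma>"
    and far: "\<And>v. v \<in> L \<Longrightarrow> \<epsilon> / 2 \<le> d_H (Gam u) (Gam v) \<Longrightarrow> norm (G v) + \<sigma> \<le> norm (G u)"
    using peaks unfolding peaks_within_def by blast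
  have near: "d_H (Gam u) (Gam v) < \<epsilon> / 2" if "v \<in> L" "sup_norm L G - \<sigma> < norm (G v)" for v
    using far[OF that(1)] that(2) C_be_norm_le_sup(2)[OF G u(1)] by linarith
  have "d_H (Gam v) (Gam w) < \<epsilon>"
    if "v \<in> L" "w \<in> L" "sup_norm L G - \<sigma> < norm (G v)" "sup_norm L G - \<sigma> < norm (G w)" for v w
    using near[of v] near[of w] that d_H_Gam_triangle[of v w u] d_H_Gam_commute[of v u]
    by linarith
  then show ?thesis
    using u(2) by (intro exI[of _ "sup_norm L G - \<sigma>"]) auto
qed

text \<open>
  Peaking at all scales makes the sets of almost maximal points shrink in \<open>d_H\<close>. A
  maximizing sequence is then Cauchy up to signs, and completeness, closedness of \<open>L\<close> and
  continuity of \<open>G\<close> give the maximum. As \<open>u\<close> and \<open>- u\<close> have distance \<open>4\<close> on the product of the spheres,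
  the signs can be fixed once and for all by comparison with a single point \<open>a\<close>.
\<close>

lemma attains_strongly_if_peaks:
  fixes L :: "('x::banach \<times> 'z::banach) set" and G :: "'x \<times> 'z \<Rightarrow> 'w::real_normed_vector"
  assumes L: "L \<subseteq> sphere 0 1 \<times> sphere 0 1" "L \<noteq> {}" "L = uminus ` L" "closed L"
    and G: "G \<in> C_be L" and peaks: "\<And>\<epsilon>. 0 < \<epsilon> \<Longrightarrow> peaks_within L \<epsilon> G"
  shows "attains_strongly L G"
proof -
  define M where "M = sup_norm L G"
  note le_M = C_be_norm_le_sup(2)[OF G, folded M_def]
  have minus_L: "- v \<in> L" if "v \<in> L" for v
    using L(3) that by blast
  have G_minus: "G (- v) = G v" if "v \<in> L" for v
    using G that unfolding C_be_def by blast
  have diam: "\<exists>c < M. \<forall>v\<in>L. \<forall>w\<in>L.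
      c < norm (G v) \<longrightarrow> c < norm (G w) \<longrightarrow> d_H (Gam v) (Gam w) < \<epsilon>" if "0 < \<epsilon>" for \<epsilon>
    unfolding M_def using that by (intro peaks_within_near_maximal_diameter G peaks) simp
  obtain c0 where "c0 < M" and c0: "\<And>v w. v \<in> L \<Longrightarrow> w \<in> L \<Longrightarrow>
      c0 < norm (G v) \<Longrightarrow> c0 < norm (G w) \<Longrightarrow> d_H (Gam v) (Gam w) < 1"
    using diam[of 1] by auto
  obtain a where a: "a \<in> L" "c0 < norm (G a)"
    using C_be_nearly_maximal_point[OF G L(2)] \<open>c0 < M\<close> unfolding M_def by blast
  \<comment> \<open>The maximizing sequence is taken on the sheet of \<open>a\<close>, where \<open>d_H\<close> is the distance itself.\<close>
  have "\<exists>v\<in>L. M - 1 / Suc n < norm (G v) \<and> sum_dist a v < 1" for n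
  proof -
    have "max c0 (M - 1 / Suc n) < M"
      using \<open>c0 < M\<close> by simp
    then obtain v where v: "v \<in> L" "max c0 (M - 1 / Suc n) < norm (G v)"
      using C_be_nearly_maximal_point[OF G L(2)] unfolding M_def by blast
    have "d_H (Gam a) (Gam v) < 1"
      using c0[OF a(1) v(1) a(2)] v(2) by simp
    then have "sum_dist a v < 1 \<or> sum_dist a (- v) < 1"
      by (auto simp: d_H_Gam_sum_dist)
    then show ?thesis
    proof
      assume "sum_dist a v < 1"
      then show ?thesis using v by auto
    next
      assume "sum_dist a (- v) < 1"
      then show ?thesis
        using v minus_L[OF v(1)] G_minus[OF v(1)] by (intro bexI[of _ "- v"]) auto
    qed
  qed
  then obtain s where s: "\<And>n. s n \<in> L" "\<And>n. M - 1 / Suc n < norm (G (s n))"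
    "\<And>n. sum_dist a (s n) < 1"
    by metis
  have d_H_s: "d_H (Gam (s m)) (Gam (s n)) = sum_dist (s m) (s n)" for m n
  proof -
    have "norm (fst (s n)) = 1" "norm (snd (s n)) = 1"
      using subsetD[OF L(1) s(1)[of n]] by (auto simp: mem_Times_iff)
    then have "sum_dist (s n) (- s n) = 4"
      by (simp add: sum_dist_def flip: mult_2 scaleR_2)
    moreover have "sum_dist (s m) (s n) < 2"
      using sum_dist_triangle[of "s m" "s n" a] s(3)[of m] s(3)[of n] sum_dist_commute[of "s m" a]
      by linarith
    ultimately show ?thesis
      using sum_dist_triangle[of "s n" "- s n" "s m"] sum_dist_commute[of "s n" "s m"]
      by (simp add: d_H_Gam_sum_dist)
  qed
  have maximizing: "(\<lambda>n. norm (G (s n))) \<longlonglongrightarrow> M"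
  proof (rule tendsto_sandwich)
    show "(\<lambda>n. M - 1 / Suc n) \<longlonglongrightarrow> M"
      using tendsto_diff[OF tendsto_const lim_1_over_n[THEN LIMSEQ_Suc], of M] by simp
    show "\<forall>\<^sub>F n in sequentially. M - 1 / Suc n \<le> norm (G (s n))"
      using s(2) by (intro always_eventually allI less_imp_le)
    show "\<forall>\<^sub>F n in sequentially. norm (G (s n)) \<le> M"
      using le_M[OF s(1)] by (intro always_eventually allI)
  qed (rule tendsto_const)
  have "Cauchy s"
  proof (rule metric_CauchyI)
    fix \<epsilon> :: real
    assume "0 < \<epsilon>"
    then obtain c where "c < M" and c: "\<And>v w. v \<in> L \<Longrightarrow> w \<in> L \<Longrightarrow>
        c < norm (G v) \<Longrightarrow> c < norm (G w) \<Longrightarrow> d_H (Gam v) (Gam w) < \<epsilon>"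
      using diam[of \<epsilon>] by blast
    obtain n0 where n0: "\<And>n. n \<ge> n0 \<Longrightarrow> c < norm (G (s n))"
      using order_tendstoD(1)[OF maximizing \<open>c < M\<close>] unfolding eventually_sequentially by blast
    have "dist (s m) (s n) < \<epsilon>" if "m \<ge> n0" "n \<ge> n0" for m n
      using c[of "s m" "s n"] s(1) n0 that d_H_s[of m n] dist_le_sum_dist[of "s m" "s n"] by force
    then show "\<exists>n0. \<forall>m\<ge>n0. \<forall>n\<ge>n0. dist (s m) (s n) < \<epsilon>"
      by blast
  qed
  then obtain u0 where u0: "s \<longlonglongrightarrow> u0"
    using Cauchy_convergent convergent_def by blast
  have "u0 \<in> L"
    using L(4) s(1) u0 by (rule closed_sequentially)
  have "(\<lambda>n. G (s n)) \<longlonglongrightarrow> G u0"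
    using G u0 \<open>u0 \<in> L\<close> s(1) unfolding C_be_def
    by (intro continuous_on_tendsto_compose[of L G]) auto
  then have max: "norm (G u0) = M"
    using LIMSEQ_unique[OF tendsto_norm maximizing] by blast
  have "(\<lambda>n. d_H (Gam (v n)) (Gam u0)) \<longlonglongrightarrow> 0"
    if v: "\<And>n. v n \<in> L" "(\<lambda>n. norm (G (v n))) \<longlonglongrightarrow> M" for v :: "nat \<Rightarrow> _"
  proof (rule LIMSEQ_I)
    fix \<epsilon> :: real
    assume "0 < \<epsilon>"
    then obtain c where "c < M" and c: "\<And>v w. v \<in> L \<Longrightarrow> w \<in> L \<Longrightarrow>
        c < norm (G v) \<Longrightarrow> c < norm (G w) \<Longrightarrow> d_H (Gam v) (Gam w) < \<epsilon>"
      using diam[of \<epsilon>] by blast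
    obtain n0 where "\<And>n. n \<ge> n0 \<Longrightarrow> c < norm (G (v n))"
      using order_tendstoD(1)[OF v(2) \<open>c < M\<close>] unfolding eventually_sequentially by blast
    then show "\<exists>n0. \<forall>n\<ge>n0. norm (d_H (Gam (v n)) (Gam u0) - 0) < \<epsilon>"
      using c[OF v(1) \<open>u0 \<in> L\<close>] max \<open>c < M\<close> by (auto simp: d_H_Gam_nonneg)
  qed
  then show ?thesis
    unfolding attains_strongly_def sup_norm_def[symmetric] M_def[symmetric]
    using \<open>u0 \<in> L\<close> max by blast
qed

section \<open>Porous sets\<close>

text \<open>
  A porous set misses a ball inside every small ball, so the union of the balls that it
  misses is open and dense, and Baire's theorem applies to countably many such unions.
\<close>

lemma sigma_porous_complement_dense:
  assumes complete: "mcomplete_of m" and A: "sigma_porous m A" and x: "x \<in> mspace m" and "0 < r"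
  shows "\<exists>y\<in>mspace m - A. mdist m x y < r"
proof -
  interpret Metric_space "mspace m" "mdist m"
    by (rule Metric_space_mspace_mdist)
  obtain \<A> where "countable \<A>" and por: "\<And>B. B \<in> \<A> \<Longrightarrow> porous m B" and A_eq: "A = \<Union>\<A>"
    using A unfolding sigma_porous_def by auto
  define U where "U B = \<Union>{mball y s |y s. mball y s \<inter> B = {}}" for B
  have U_open: "openin mtopology (U B)" for B
    unfolding U_def by (intro openin_Union) auto
  have U_dense: "mtopology closure_of U B = mspace m" if B: "B \<in> \<A>" for B
  proof -
    obtain l r0 where l: "0 < l" "0 < r0" and hole: "\<And>z r. z \<in> mspace m \<Longrightarrow> 0 < r \<Longrightarrow> r \<le> r0 \<Longrightarrow>
        \<exists>y\<in>mspace m. mball y (l * r) \<subseteq> mball z r \<inter> (mspace m - B)"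
      using por[OF B] unfolding porous_def mball_of_def by auto
    have "\<exists>y\<in>U B. y \<in> mball z r" if z: "z \<in> mspace m" "0 < r" for z r
    proof -
      have r: "0 < min r r0" "min r r0 \<le> r0"
        using z l by auto
      obtain y where y: "y \<in> mspace m" "mball y (l * min r r0) \<subseteq> mball z (min r r0) \<inter> (mspace m - B)"
        using hole[OF z(1) r] by blast
      have "y \<in> mball y (l * min r r0)"
        using y(1) l(1) r(1) by simp
      moreover have "mball y (l * min r r0) \<subseteq> U B"
        using y(2) unfolding U_def by blast
      moreover have "mball z (min r r0) \<subseteq> mball z r"
        by (rule mball_subset_concentric) simp
      ultimately show ?thesis
        using y(2) by blast
    qed
    then show ?thesis
      unfolding metric_closure_of by blast
  qed
  have "mtopology closure_of \<Inter>(U ` \<A>) = mspace m"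
  proof (rule metric_Baire_category)
    show "mcomplete"
      using complete unfolding mcomplete_of_def .
  qed (use \<open>countable \<A>\<close> U_open U_dense in auto)
  then obtain y where y: "y \<in> \<Inter>(U ` \<A>)" "y \<in> mball x r"
    using x \<open>0 < r\<close> unfolding metric_closure_of by blast
  have "y \<notin> B" if "B \<in> \<A>" for B
    using y(1) that unfolding U_def by blast
  then show ?thesis
    using y(2) by (auto simp: A_eq)
qed

lemma porous_subset:
  assumes B: "porous m B" and AB: "A \<subseteq> B"
  shows "porous m A"
proof -
  obtain l r0 where l: "0 < l" "l \<le> 1" "0 < r0" and "B \<subseteq> mspace m"
    and hole: "\<forall>x\<in>mspace m. \<forall>r. 0 < r \<and> r \<le> r0 \<longrightarrow>
      (\<exists>y\<in>mspace m. mball_of m y (l * r) \<subseteq> mball_of m x r \<inter> (mspace m - B))"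
    using B unfolding porous_def by (elim conjE exE)
  have "\<exists>y\<in>mspace m. mball_of m y (l * r) \<subseteq> mball_of m x r \<inter> (mspace m - A)"
    if xr: "x \<in> mspace m" "0 < r" "r \<le> r0" for x r
  proof -
    obtain y where "y \<in> mspace m" "mball_of m y (l * r) \<subseteq> mball_of m x r \<inter> (mspace m - B)"
      using hole xr by blast
    then show ?thesis
      using AB by (intro bexI[of _ y]) auto
  qed
  then show ?thesis
    unfolding porous_def using l AB \<open>B \<subseteq> mspace m\<close>
    by (intro conjI exI[of _ l] exI[of _ r0]) auto
qed

lemma sigma_porous_countable_cover:
  fixes B :: "nat \<Rightarrow> 'a set"
  assumes por: "\<And>n. porous m (B n)" and A: "A \<subseteq> (\<Union>n. B n)"
  shows "sigma_porous m A"
proof -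
  have "porous m (A \<inter> B n)" for n
    using por[of n] by (rule porous_subset) simp
  then have "\<forall>C\<in>range (\<lambda>n. A \<inter> B n). porous m C"
    by blast
  moreover have "A = \<Union>(range (\<lambda>n. A \<inter> B n))"
    using A by blast
  ultimately show ?thesis
    unfolding sigma_porous_def by (intro exI[of _ "range (\<lambda>n. A \<inter> B n)"]) auto
qed

section \<open>Perturbation by a peak function\<close>

lemma op_oplus_eq: "v \<in> L \<Longrightarrow> op_oplus L T w v = pairing T v *\<^sub>R w"
  by (cases v) (simp add: op_oplus_def pairing_def)

lemma unit_direction:
  fixes g :: "'w::real_normed_vector"
  assumes "(UNIV :: 'w set) \<noteq> {0}"
  shows "\<exists>w. norm w = 1 \<and> g = norm g *\<^sub>R w"
proof (cases "g = 0")
  case True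
  obtain h :: 'w where "h \<noteq> 0"
    using assms by blast
  then show ?thesis
    using True by (intro exI[of _ "sgn h"]) (simp add: norm_sgn)
next
  case False
  then show ?thesis
    by (intro exI[of _ "sgn g"]) (simp add: norm_sgn sgn_div_norm)
qed

text \<open>
  The direction \<open>w\<close> is that of \<open>G u\<close>, so at \<open>u\<close> the perturbation adds to the norm with its full
  signed size \<open>c * pairing T u\<close>; elsewhere it adds at most its absolute value, which is smaller by
  \<open>c * \<rho>\<close>. The defect \<open>\<delta>\<close> of \<open>u\<close> as an almost maximum is charged against this gain.
\<close>

lemma peak_perturbation_gap:
  fixes G :: "'x::real_normed_vector \<times> ('y::real_normed_vector \<Rightarrow>\<^sub>L real) \<Rightarrow> 'w::real_normed_vector"
  assumes u: "u \<in> L" and v: "v \<in> L" and le: "norm (G v) \<le> M" and near: "M - \<delta> \<le> norm (G u)"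
    and w: "norm w = 1" "G u = norm (G u) *\<^sub>R w" and "0 \<le> c"
    and T: "\<bar>pairing T v\<bar> + \<rho> \<le> pairing T u"
  shows "norm (G v + op_oplus L T (c *\<^sub>R w) v) + (c * \<rho> - \<delta>)
    \<le> norm (G u + op_oplus L T (c *\<^sub>R w) u)"
proof -
  have "norm (G v + op_oplus L T (c *\<^sub>R w) v) \<le> M + c * \<bar>pairing T v\<bar>"
    using norm_triangle_ineq[of "G v" "op_oplus L T (c *\<^sub>R w) v"] le w(1) \<open>0 \<le> c\<close>
    by (simp add: op_oplus_eq[OF v] abs_mult mult.commute)
  moreover have "c * (\<bar>pairing T v\<bar> + \<rho>) \<le> c * pairing T u"
    using T \<open>0 \<le> c\<close> by (rule mult_left_mono)
  moreover have "G u + op_oplus L T (c *\<^sub>R w) u = (norm (G u) + c * pairing T u) *\<^sub>R w"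
    using w(2) by (simp add: op_oplus_eq[OF u] scaleR_left_distrib mult.commute)
  then have "norm (G u + op_oplus L T (c *\<^sub>R w) u) = \<bar>norm (G u) + c * pairing T u\<bar>"
    using w(1) by simp
  ultimately show ?thesis
    using near by (simp add: distrib_left)
qed

lemma gap_stable:
  assumes "norm (H v) + \<sigma> \<le> norm (H u)" "norm (K v - H v) \<le> \<tau>" "norm (K u - H u) \<le> \<tau>"
  shows "norm (K v) + (\<sigma> - 2 * \<tau>) \<le> norm (K u)"
  using assms norm_triangle_ineq2[of "K v" "H v"] norm_triangle_ineq3[of "K u" "H u"] by linarith

lemma C_be_add: "F \<in> C_be L \<Longrightarrow> G \<in> C_be L \<Longrightarrow> (\<lambda>u. F u + G u) \<in> C_be L"
  unfolding C_be_def by (auto intro: continuous_on_add bounded_plus_comp)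

lemma C_be_0: "(\<lambda>u. 0) \<in> C_be L"
  by (auto simp: C_be_def bounded_iff)

lemma sup_norm_le: "L \<noteq> {} \<Longrightarrow> (\<And>u. u \<in> L \<Longrightarrow> norm (F u) \<le> b) \<Longrightarrow> sup_norm L F \<le> b"
  unfolding sup_norm_def by (rule cSUP_least)

section \<open>Genericity and norm attainment in the perturbation space\<close>

text \<open>
  The last two assumptions say that a peak function can be added to an element of \<open>Z\<close>, in any
  direction \<open>w\<close>, at a cost in the norm \<open>N\<close> that is at most its size.
\<close>

locale finite_rank_perturbations =
  fixes L :: "('x::banach \<times> ('y::banach \<Rightarrow>\<^sub>L real)) set"
    and Z :: "('x \<times> ('y \<Rightarrow>\<^sub>L real) \<Rightarrow> 'w::banach) set"
    and N :: "('x \<times> ('y \<Rightarrow>\<^sub>L real) \<Rightarrow> 'w) \<Rightarrow> real"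
  assumes W_nonzero: "(UNIV :: 'w set) \<noteq> {0}"
    and L: "L \<subseteq> sphere 0 1 \<times> sphere 0 1" "L \<noteq> {}" "L = uminus ` L" "closed L" "property_P L"
    and Z: "banach_included_in Z N (C_be L)"
    and sup_norm_le_N: "\<And>\<Phi>. \<Phi> \<in> Z \<Longrightarrow> sup_norm L \<Phi> \<le> N \<Phi>"
    and op_oplus_in_Z: "\<And>T w. T \<in> finite_rank \<Longrightarrow> op_oplus L T w \<in> Z"
    and N_op_oplus: "\<And>T w. T \<in> finite_rank \<Longrightarrow> N (op_oplus L T w) \<le> norm T * norm w"
begin

lemma Z_C_be: "\<Phi> \<in> Z \<Longrightarrow> \<Phi> \<in> C_be L"
  and Z_subspace: "function_subspace Z"
  and N_norm: "norm_on Z N"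
  and Z_complete: "mcomplete_of (norm_metric Z N)"
  using Z by (auto simp: banach_included_in_def)

lemma Z_add: "\<Phi> \<in> Z \<Longrightarrow> \<Psi> \<in> Z \<Longrightarrow> (\<lambda>u. \<Phi> u + \<Psi> u) \<in> Z"
  and Z_scale: "\<Phi> \<in> Z \<Longrightarrow> (\<lambda>u. c *\<^sub>R \<Phi> u) \<in> Z"
  using Z_subspace by (auto simp: function_subspace_def)

lemma mspace_norm_metric [simp]: "mspace (norm_metric Z N) = Z"
  unfolding norm_metric_def
  by (rule Metric_space.mspace_metric[OF Metric_space_norm_metric[OF Z_subspace N_norm]])

lemma mdist_norm_metric:
  "\<Phi> \<in> Z \<Longrightarrow> \<Psi> \<in> Z \<Longrightarrow> mdist (norm_metric Z N) \<Phi> \<Psi> = N (\<lambda>u. \<Phi> u - \<Psi> u)"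
  unfolding norm_metric_def
  by (simp add: Metric_space.mdist_metric[OF Metric_space_norm_metric[OF Z_subspace N_norm]])

lemma norm_le_N: "\<Phi> \<in> Z \<Longrightarrow> u \<in> L \<Longrightarrow> norm (\<Phi> u) \<le> N \<Phi>"
  using C_be_norm_le_sup(2)[OF Z_C_be] sup_norm_le_N by (rule order_trans)

lemma norm_diff_le_mdist:
  assumes "\<Phi> \<in> Z" "\<Psi> \<in> Z" "u \<in> L"
  shows "norm (\<Phi> u - \<Psi> u) \<le> mdist (norm_metric Z N) \<Phi> \<Psi>"
  using norm_le_N[OF function_subspace_diff[OF Z_subspace assms(1,2)] assms(3)] assms
  by (simp add: mdist_norm_metric)

lemma N_op_oplus_scaled_le:
  assumes "T \<in> finite_rank" "norm T \<le> 1" "norm w = 1" "0 \<le> c"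
  shows "N (op_oplus L T (c *\<^sub>R w)) \<le> c"
  using N_op_oplus[OF assms(1), of "c *\<^sub>R w"] mult_right_mono[OF assms(2,4)] assms(3,4) by simp

text \<open>
  In the ball of radius \<open>r\<close> about \<open>\<Phi>\<close>, a peak function of size \<open>r / 2\<close> at an almost maximal point,
  chosen with defect \<open>r * \<rho> / 4\<close>, leaves a margin \<open>r * \<rho> / 4\<close>. Moving by \<open>\<tau>\<close> costs
  \<open>2 * \<tau>\<close> of the margin, so all functions within \<open>\<rho> * r / 16\<close> still peak; replacing \<open>\<rho>\<close> by
  \<open>min \<rho> 1\<close> keeps these functions within \<open>r\<close> of \<open>\<Phi>\<close>. Everything scales with
  \<open>r\<close>, which is what porosity, as opposed to nowhere density, requires.
\<close>

lemma porous_non_peaking: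
  assumes \<Theta>: "\<Theta> \<in> C_be L" and "0 < \<epsilon>"
  shows "porous (norm_metric Z N) {\<Phi>\<in>Z. \<not> peaks_within L \<epsilon> (\<lambda>u. \<Theta> u + \<Phi> u)}"
proof -
  let ?m = "norm_metric Z N"
  obtain \<rho> where "0 < \<rho>" and peak: "\<And>u. u \<in> L \<Longrightarrow> \<exists>T\<in>finite_rank. norm T \<le> 1 \<and>
      (\<forall>v\<in>L. \<epsilon> \<le> d_H (Gam u) (Gam v) \<longrightarrow> \<bar>pairing T v\<bar> + \<rho> \<le> pairing T u)"
    using property_P_peak_operators[OF L(5,1) \<open>0 < \<epsilon>\<close>] by blast
  define l where "l = min \<rho> 1 / 16"
  have l: "0 < l" "l \<le> 1/16" "l \<le> \<rho> / 16"
    using \<open>0 < \<rho>\<close> by (auto simp: l_def)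
  have "\<exists>\<Psi>\<in>Z. mball_of ?m \<Psi> (l * r) \<subseteq>
      mball_of ?m \<Phi> r \<inter> (Z - {\<Phi>\<in>Z. \<not> peaks_within L \<epsilon> (\<lambda>u. \<Theta> u + \<Phi> u)})"
    if \<Phi>: "\<Phi> \<in> Z" and "0 < r" for \<Phi> r
  proof -
    define G where "G u = \<Theta> u + \<Phi> u" for u
    have G: "G \<in> C_be L"
      unfolding G_def by (rule C_be_add[OF \<Theta> Z_C_be[OF \<Phi>]])
    have "sup_norm L G - r * \<rho> / 4 < sup_norm L G"
      using \<open>0 < r\<close> \<open>0 < \<rho>\<close> by simp
    then obtain u where u: "u \<in> L" "sup_norm L G - r * \<rho> / 4 < norm (G u)"
      using C_be_nearly_maximal_point[OF G L(2)] by blast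
    obtain T where T: "T \<in> finite_rank" "norm T \<le> 1" and gap: "\<And>v. v \<in> L \<Longrightarrow>
        \<epsilon> \<le> d_H (Gam u) (Gam v) \<Longrightarrow> \<bar>pairing T v\<bar> + \<rho> \<le> pairing T u"
      using peak[OF u(1)] by blast
    obtain w where w: "norm w = 1" "G u = norm (G u) *\<^sub>R w"
      using unit_direction[OF W_nonzero] by blast
    define E where "E = op_oplus L T ((r / 2) *\<^sub>R w)"
    have E: "E \<in> Z" "N E \<le> r / 2"
      unfolding E_def using op_oplus_in_Z T(1) N_op_oplus_scaled_le[OF T w(1), of "r / 2"] \<open>0 < r\<close>
      by auto
    define \<Psi> where "\<Psi> u = \<Phi> u + E u" for u
    have \<Psi>: "\<Psi> \<in> Z"
      unfolding \<Psi>_def by (rule Z_add[OF \<Phi> E(1)])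
    have \<Psi>_\<Phi>: "mdist ?m \<Phi> \<Psi> \<le> r / 2"
      using E(2) mdist_norm_metric[OF \<Psi> \<Phi>] mdist_commute[of ?m \<Phi> \<Psi>] by (simp add: \<Psi>_def)
    have \<Psi>_gap: "norm (\<Theta> v + \<Psi> v) + r * \<rho> / 4 \<le> norm (\<Theta> u + \<Psi> u)"
      if "v \<in> L" "\<epsilon> \<le> d_H (Gam u) (Gam v)" for v
      using peak_perturbation_gap[where G = G and c = "r / 2" and \<delta> = "r * \<rho> / 4" and T = T and \<rho> = \<rho>,
          OF u(1) that(1) C_be_norm_le_sup(2)[OF G that(1)] less_imp_le[OF u(2)] w _ gap[OF that]]
        \<open>0 < r\<close> by (simp add: G_def \<Psi>_def E_def add.assoc mult.commute)
    have "K \<in> mball_of ?m \<Phi> r \<and> peaks_within L \<epsilon> (\<lambda>u. \<Theta> u + K u)"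
      if K: "K \<in> Z" "mdist ?m \<Psi> K < l * r" for K
    proof
      have lr: "l * r \<le> r / 16" "l * r \<le> r * \<rho> / 16"
        using l(2,3) \<open>0 < r\<close> by (auto simp: field_simps)
      have "mdist ?m \<Phi> K \<le> mdist ?m \<Phi> \<Psi> + mdist ?m \<Psi> K"
        using \<Phi> \<Psi> K(1) by (intro mdist_triangle) auto
      then have "mdist ?m \<Phi> K < r"
        using \<Psi>_\<Phi> K(2) lr(1) \<open>0 < r\<close> by linarith
      then show "K \<in> mball_of ?m \<Phi> r"
        using \<Phi> K(1) by simp
      have close: "norm (\<Theta> v + K v - (\<Theta> v + \<Psi> v)) \<le> r * \<rho> / 16" if "v \<in> L" for v
      proof -
        have "norm (K v - \<Psi> v) \<le> r * \<rho> / 16"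
          using norm_diff_le_mdist[OF K(1) \<Psi> that] K(2) lr(2) mdist_commute[of ?m K \<Psi>]
          by linarith
        then show ?thesis by simp
      qed
      have "norm (\<Theta> v + K v) + r * \<rho> / 8 \<le> norm (\<Theta> u + K u)"
        if "v \<in> L" "\<epsilon> \<le> d_H (Gam u) (Gam v)" for v
        using gap_stable[of "\<lambda>v. \<Theta> v + \<Psi> v", OF \<Psi>_gap[OF that] close[OF that(1)] close[OF u(1)]]
        by (simp add: mult.commute)
      then show "peaks_within L \<epsilon> (\<lambda>u. \<Theta> u + K u)"
        unfolding peaks_within_def using u(1) \<open>0 < r\<close> \<open>0 < \<rho>\<close>
        by (intro bexI[of _ u] exI[of _ "r * \<rho> / 8"]) auto
    qed
    then show ?thesis
      using \<Psi> by (intro bexI[of _ \<Psi>]) auto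
  qed
  then show ?thesis
    unfolding porous_def using l by (intro conjI exI[of _ l] exI[of _ 1]) auto
qed

text \<open>
  A function that peaks at the scales \<open>1 / (n + 1)\<close> peaks at all scales and hence attains its
  maximum strongly.
\<close>

theorem sigma_porous_non_attaining:
  assumes \<Theta>: "\<Theta> \<in> C_be L"
  shows "sigma_porous (norm_metric Z N) (Z - {\<Phi>\<in>Z. attains_strongly L (\<lambda>u. \<Theta> u + \<Phi> u)})"
proof (rule sigma_porous_countable_cover)
  show "porous (norm_metric Z N)
      {\<Phi>\<in>Z. \<not> peaks_within L (inverse (real (Suc n))) (\<lambda>u. \<Theta> u + \<Phi> u)}" for n
    by (rule porous_non_peaking[OF \<Theta>]) simp
  show "Z - {\<Phi>\<in>Z. attains_strongly L (\<lambda>u. \<Theta> u + \<Phi> u)} \<subseteq>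
      (\<Union>n. {\<Phi>\<in>Z. \<not> peaks_within L (inverse (real (Suc n))) (\<lambda>u. \<Theta> u + \<Phi> u)})"
  proof (rule subsetI, rule ccontr)
    fix \<Phi>
    assume \<Phi>: "\<Phi> \<in> Z - {\<Phi>\<in>Z. attains_strongly L (\<lambda>u. \<Theta> u + \<Phi> u)}"
      and "\<Phi> \<notin> (\<Union>n. {\<Phi>\<in>Z. \<not> peaks_within L (inverse (real (Suc n))) (\<lambda>u. \<Theta> u + \<Phi> u)})"
    then have all: "peaks_within L (inverse (real (Suc n))) (\<lambda>u. \<Theta> u + \<Phi> u)" for n
      by blast
    have "peaks_within L \<epsilon> (\<lambda>u. \<Theta> u + \<Phi> u)" if "0 < \<epsilon>" for \<epsilon>
      using reals_Archimedean[OF that] all by (blast intro: peaks_within_mono less_imp_le)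
    then have "attains_strongly L (\<lambda>u. \<Theta> u + \<Phi> u)"
      using \<Phi> by (intro attains_strongly_if_peaks[OF L(1-4)] C_be_add[OF \<Theta>] Z_C_be) auto
    then show False
      using \<Phi> by blast
  qed
qed

text \<open>
  A peak function of size \<open>c\<close> at \<open>u\<close> lifts the value there by \<open>c * \<rho>\<close> relative to the values outside
  the \<open>\<epsilon>\<close>-neighbourhood of \<open>\<plusminus>u\<close>; with \<open>\<eta> = c * \<rho> / 2\<close>, half of this compensates the defect
  \<open>1 - norm (\<Phi> u)\<close> and the other half is a margin. By density some function \<open>K\<close> as close as
  desired attains its norm, necessarily in that neighbourhood, and evenness of \<open>K\<close> lets the point be
  chosen near \<open>u\<close> itself. Normalizing \<open>K\<close> at most doubles the bound \<open>2 * c\<close> on the distance to \<open>\<Phi>\<close>.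
\<close>

theorem Bishop_Phelps_Bollobas:
  assumes "0 < \<epsilon>"
  shows "\<exists>\<eta>>0. \<forall>\<Phi>\<in>Z. \<forall>u\<in>L. sup_norm L \<Phi> = 1 \<and> norm (\<Phi> u) > 1 - \<eta> \<longrightarrow>
    (\<exists>\<Psi>\<in>Z. \<exists>v\<in>L. sup_norm L \<Psi> = 1 \<and> norm (\<Psi> v) = 1 \<and>
      sum_dist u v < \<epsilon> \<and> sup_norm L (\<lambda>u. \<Psi> u - \<Phi> u) < \<epsilon>)"
proof -
  let ?m = "norm_metric Z N"
  obtain \<rho> where "0 < \<rho>" and peak: "\<And>u. u \<in> L \<Longrightarrow> \<exists>T\<in>finite_rank. norm T \<le> 1 \<and>
      (\<forall>v\<in>L. \<epsilon> \<le> d_H (Gam u) (Gam v) \<longrightarrow> \<bar>pairing T v\<bar> + \<rho> \<le> pairing T u)"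
    using property_P_peak_operators[OF L(5,1) \<open>0 < \<epsilon>\<close>] by blast
  define c where "c = min \<epsilon> 1 / 8"
  have c: "0 < c" "c \<le> 1/8" "4 * c < \<epsilon>"
    using \<open>0 < \<epsilon>\<close> by (auto simp: c_def)
  have "\<exists>\<Psi>\<in>Z. \<exists>v\<in>L. sup_norm L \<Psi> = 1 \<and> norm (\<Psi> v) = 1 \<and>
      sum_dist u v < \<epsilon> \<and> sup_norm L (\<lambda>u. \<Psi> u - \<Phi> u) < \<epsilon>"
    if \<Phi>: "\<Phi> \<in> Z" and u: "u \<in> L" and sup_1: "sup_norm L \<Phi> = 1"
      and near: "1 - c * \<rho> / 2 < norm (\<Phi> u)" for \<Phi> u
  proof -
    obtain T where T: "T \<in> finite_rank" "norm T \<le> 1" and gap: "\<And>v. v \<in> L \<Longrightarrow>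
        \<epsilon> \<le> d_H (Gam u) (Gam v) \<Longrightarrow> \<bar>pairing T v\<bar> + \<rho> \<le> pairing T u"
      using peak[OF u] by blast
    obtain w where w: "norm w = 1" "\<Phi> u = norm (\<Phi> u) *\<^sub>R w"
      using unit_direction[OF W_nonzero] by blast
    define E where "E = op_oplus L T (c *\<^sub>R w)"
    have E: "E \<in> Z" "N E \<le> c"
      unfolding E_def using op_oplus_in_Z T(1) N_op_oplus_scaled_le[OF T w(1), of c] c(1)
      by auto
    define H where "H u = \<Phi> u + E u" for u
    have H: "H \<in> Z"
      unfolding H_def by (rule Z_add[OF \<Phi> E(1)])
    have \<Phi>_le: "norm (\<Phi> v) \<le> 1" if "v \<in> L" for v
      using C_be_norm_le_sup(2)[OF Z_C_be[OF \<Phi>] that] sup_1 by simp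
    have H_gap: "norm (H v) + c * \<rho> / 2 \<le> norm (H u)"
      if "v \<in> L" "\<epsilon> \<le> d_H (Gam u) (Gam v)" for v
      using peak_perturbation_gap[where c = c and T = T and \<rho> = \<rho>,
          OF u that(1) \<Phi>_le[OF that(1)] less_imp_le[OF near] w less_imp_le[OF c(1)] gap[OF that]]
      by (simp add: H_def E_def mult.commute)
    \<comment> \<open>At most a quarter of the margin in \<open>H_gap\<close>, so that the peak survives, and at most \<open>c\<close>, the
      bound on \<open>N E\<close>, so that \<open>K\<close> stays within \<open>2 * c\<close> of \<open>\<Phi>\<close>.\<close>
    define \<tau> where "\<tau> = min c (c * \<rho> / 8)"
    have \<tau>: "0 < \<tau>" "\<tau> \<le> c" "\<tau> \<le> c * \<rho> / 8"
      using c(1) \<open>0 < \<rho>\<close> by (auto simp: \<tau>_def)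
    obtain K where K: "K \<in> Z" "attains_strongly L K" "mdist ?m H K < \<tau>"
      using sigma_porous_complement_dense[OF Z_complete sigma_porous_non_attaining[OF C_be_0] _ \<tau>(1)] H
      by auto
    have K_H: "norm (K v - H v) \<le> \<tau>" if "v \<in> L" for v
      using norm_diff_le_mdist[OF K(1) H that] K(3) mdist_commute[of ?m K H] by simp
    have K_\<Phi>: "norm (K v - \<Phi> v) \<le> 2 * c" if "v \<in> L" for v
      using K_H[OF that] norm_le_N[OF E(1) that] E(2) \<tau>(2) norm_triangle_ineq[of "K v - H v" "E v"]
      by (simp add: H_def)
    define m where "m = sup_norm L K"
    have K_le: "norm (K v) \<le> m" if "v \<in> L" for v
      unfolding m_def by (rule C_be_norm_le_sup(2)[OF Z_C_be[OF K(1)] that])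
    have "m \<le> 1 + 2 * c"
      unfolding m_def
    proof (rule sup_norm_le[OF L(2)])
      show "norm (K v) \<le> 1 + 2 * c" if "v \<in> L" for v
        using K_\<Phi>[OF that] \<Phi>_le[OF that] norm_triangle_ineq2[of "K v" "\<Phi> v"] by simp
    qed
    moreover have "sup_norm L \<Phi> \<le> m + 2 * c"
    proof (rule sup_norm_le[OF L(2)])
      show "norm (\<Phi> v) \<le> m + 2 * c" if "v \<in> L" for v
        using K_\<Phi>[OF that] K_le[OF that] norm_triangle_ineq3[of "K v" "\<Phi> v"] by simp
    qed
    ultimately have m: "0 < m" "\<bar>1 - m\<bar> \<le> 2 * c"
      using sup_1 c(2) by auto
    obtain v0 where v0: "v0 \<in> L" "norm (K v0) = m"
      using K(2) unfolding attains_strongly_def m_def sup_norm_def by blast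
    have "d_H (Gam u) (Gam v0) < \<epsilon>"
    proof (rule ccontr)
      assume "\<not> ?thesis"
      then have "norm (K v0) + (c * \<rho> / 2 - 2 * \<tau>) \<le> norm (K u)"
        using gap_stable[of H, OF H_gap[OF v0(1)] K_H[OF v0(1)] K_H[OF u]] by simp
      moreover have "0 < c * \<rho>"
        using c(1) \<open>0 < \<rho>\<close> by simp
      ultimately show False
        using v0(2) K_le[OF u] \<tau>(3) by simp
    qed
    then have "sum_dist u v0 < \<epsilon> \<or> sum_dist u (- v0) < \<epsilon>"
      by (simp add: d_H_Gam_sum_dist min_less_iff_disj)
    moreover have "- v0 \<in> L" "K (- v0) = K v0"
      using v0(1) L(3) Z_C_be[OF K(1)] by (auto simp: C_be_def)
    ultimately obtain v where v: "v \<in> L" "norm (K v) = m" "sum_dist u v < \<epsilon>"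
      using v0 by metis
    define \<Psi> where "\<Psi> u = (1 / m) *\<^sub>R K u" for u
    have "\<Psi> \<in> Z"
      unfolding \<Psi>_def by (rule Z_scale[OF K(1)])
    moreover have \<Psi>_v: "norm (\<Psi> v) = 1"
      using v(2) m(1) by (simp add: \<Psi>_def)
    moreover have "sup_norm L \<Psi> = 1"
    proof (rule antisym)
      show "sup_norm L \<Psi> \<le> 1"
        using K_le m(1) by (intro sup_norm_le[OF L(2)]) (simp add: \<Psi>_def)
      show "1 \<le> sup_norm L \<Psi>"
        using C_be_norm_le_sup(2)[OF Z_C_be[OF \<open>\<Psi> \<in> Z\<close>] v(1)] \<Psi>_v by simp
    qed
    moreover have "sup_norm L (\<lambda>u. \<Psi> u - \<Phi> u) \<le> 4 * c"
    proof (rule sup_norm_le[OF L(2)])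
      fix z
      assume z: "z \<in> L"
      have "norm (\<Psi> z - K z) = \<bar>1 - m\<bar> * (norm (K z) / m)"
      proof -
        have "\<Psi> z - K z = ((1 - m) / m) *\<^sub>R K z"
          using m(1) by (simp add: \<Psi>_def diff_divide_distrib scaleR_left_diff_distrib)
        then show ?thesis
          using m(1) by simp
      qed
      also have "\<dots> \<le> \<bar>1 - m\<bar> * 1"
        using K_le[OF z] m(1) by (intro mult_left_mono) auto
      finally show "norm (\<Psi> z - \<Phi> z) \<le> 4 * c"
        using K_\<Phi>[OF z] m(2) norm_triangle_ineq[of "\<Psi> z - K z" "K z - \<Phi> z"] by simp
    qed
    ultimately show ?thesis
      using v c(3) by (intro bexI[of _ \<Psi>] bexI[of _ v]) auto
  qed
  then show ?thesis
    using c(1) \<open>0 < \<rho>\<close> by (intro exI[of _ "c * \<rho> / 2"]) auto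
qed

end

section \<open>Strong maxima under property (P)\<close>

theorem theorem1:
  fixes L :: "('x::banach \<times> ('y::banach \<Rightarrow>\<^sub>L real)) set"
    and Z :: "('x \<times> ('y \<Rightarrow>\<^sub>L real) \<Rightarrow> 'w::banach) set"
    and N :: "('x \<times> ('y \<Rightarrow>\<^sub>L real) \<Rightarrow> 'w) \<Rightarrow> real"
  assumes nonzero: "(UNIV :: 'x set) \<noteq> {0}" "(UNIV :: 'y set) \<noteq> {0}" "(UNIV :: 'w set) \<noteq> {0}"
    and L: "L \<subseteq> sphere 0 1 \<times> sphere 0 1" "L \<noteq> {}" "L = uminus ` L" "closed L" "property_P L"
    and Z: "banach_included_in Z N (C_be L)"
    and i: "\<And>\<Phi>. \<Phi> \<in> Z \<Longrightarrow> sup_norm L \<Phi> \<le> N \<Phi>"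
    and ii: "\<And>T w. T \<in> finite_rank \<Longrightarrow> op_oplus L T w \<in> Z"
      "\<And>T w. T \<in> finite_rank \<Longrightarrow> N (op_oplus L T w) \<le> norm T * norm w"
  shows "(\<forall>\<Theta>\<in>C_be L. sigma_porous (norm_metric Z N)
            (Z - {\<Phi>\<in>Z. attains_strongly L (\<lambda>u. \<Theta> u + \<Phi> u)})) \<and>
         (\<forall>\<epsilon>>0. \<exists>\<eta>>0. \<forall>\<Phi>\<in>Z. \<forall>(x, ys)\<in>L.
            sup_norm L \<Phi> = 1 \<and> norm (\<Phi> (x, ys)) > 1 - \<eta> \<longrightarrow>
            (\<exists>\<Psi>\<in>Z. \<exists>(z, ts)\<in>L. sup_norm L \<Psi> = 1 \<and> norm (\<Psi> (z, ts)) = 1 \<and>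
               norm (x - z) + norm (ys - ts) < \<epsilon> \<and> sup_norm L (\<lambda>u. \<Psi> u - \<Phi> u) < \<epsilon>))"
proof -
  interpret finite_rank_perturbations L Z N
    by (unfold_locales; fact)
  show ?thesis
    using sigma_porous_non_attaining Bishop_Phelps_Bollobas
    by (simp add: case_prod_beta sum_dist_def)
qed

end
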